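(* Let $$\varphi_R(z)=1+\frac{z(1+\sqrt2+z)}{(1+\sqrt2)(1+\sqrt2-z)},\qquad \varphi_S(z)=1+\sin z,\qquad z\in\mathbb D.$$ Then $$R_{\mathcal S^*(\varphi_S)}(\mathcal S^*(\varphi_R))=\frac{(1+\sqrt2)\left(\sqrt{1+6\sin1+\sin^2 1}-1-\sin1\right)}{2}.$$
   Context: Let $\mathbb D=\{z\in\mathbb C:|z|<1\}$ and let $\mathcal A$ be the class of functions $f$ analytic on $\mathbb D$ with $f(0)=0$ and $f'(0)=1$. For an analytic function $\varphi$ on $\mathbb D$ with $\varphi(0)=1$, the class $\mathcal S^*(\varphi)$ consists of all $f\in\mathcal A$ with $zf'(z)/f(z)\prec\varphi(z)$; that is, there is an analytic $\omega:\mathbb D\to\mathbb D$ with $\omega(0)=0$ such that $zf'(z)/f(z)=\varphi(\omega(z))$ on $\mathbb D$ (the quotient takes the value $1$ at $z=0$, and $f$ has no other zeros). For two such functions $\varphi_1,\varphi_2$, the sharp $\mathcal S^*(\varphi_2)$-radius of $\mathcal S^*(\varphi_1)$ is $$R_{\mathcal S^*(\varphi_2)}(\mathcal S^*(\varphi_1))=\sup\left\{r\in(0,1]: f_r(z)=\tfrac{f(rz)}{r}\text{ belongs to }\mathcal S^*(\varphi_2)\text{ for every } f\in\mathcal S^*(\varphi_1)\right\}.$$ *)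

theory Defs
  imports "HOL-Complex_Analysis.Complex_Analysis"
begin

text \<open>
  Functions on the open unit disc are total functions on the complex numbers whose values outside
  \<^term>\<open>ball (0::complex) 1\<close> are never used.
\<close>

definition class_A :: "(complex \<Rightarrow> complex) set" where
  "class_A = {f. f holomorphic_on ball 0 1 \<and> f 0 = 0 \<and> deriv f 0 = 1}"

definition subordinate :: "(complex \<Rightarrow> complex) \<Rightarrow> (complex \<Rightarrow> complex) \<Rightarrow> bool" where
  "subordinate h \<phi> \<longleftrightarrow>
     (\<exists>\<omega>. \<omega> holomorphic_on ball 0 1 \<and> \<omega> ` ball 0 1 \<subseteq> ball 0 1 \<and> \<omega> 0 = 0 \<and>
          (\<forall>z\<in>ball 0 1. h z = \<phi> (\<omega> z)))"

text \<open>The singularity at 0 is removable for normalised functions, with limit 1.\<close>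

definition starlike_quotient :: "(complex \<Rightarrow> complex) \<Rightarrow> complex \<Rightarrow> complex" where
  "starlike_quotient f z = (if z = 0 then 1 else z * deriv f z / f z)"

text \<open>
  The absence of zeros other than 0 is implicit in the quotient being analytic on the disc; it is
  stated explicitly because division by zero is total in HOL.  The class is intended for
  \<^term>\<open>\<phi>\<close> holomorphic on the disc with \<^term>\<open>\<phi> 0 = (1::complex)\<close>.
\<close>

definition S_star :: "(complex \<Rightarrow> complex) \<Rightarrow> (complex \<Rightarrow> complex) set" where
  "S_star \<phi> = {f \<in> class_A. (\<forall>z\<in>ball 0 1 - {0}. f z \<noteq> 0) \<and> subordinate (starlike_quotient f) \<phi>}"

text \<open>
  \<^term>\<open>S_star_radius \<phi>\<^sub>2 \<phi>\<^sub>1\<close> is the sharp radius $R_{S^*(\varphi_2)}(S^*(\varphi_1))$: the target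
  class comes first.
\<close>

definition S_star_radius :: "(complex \<Rightarrow> complex) \<Rightarrow> (complex \<Rightarrow> complex) \<Rightarrow> real" where
  "S_star_radius \<phi>\<^sub>2 \<phi>\<^sub>1 =
     Sup {r \<in> {0<..1}. \<forall>f\<in>S_star \<phi>\<^sub>1.
            (\<lambda>z. f (complex_of_real r * z) / complex_of_real r) \<in> S_star \<phi>\<^sub>2}"

definition phi_R :: "complex \<Rightarrow> complex" where
  "phi_R z = 1 + z * (complex_of_real (1 + sqrt 2) + z) /
                   (complex_of_real (1 + sqrt 2) * (complex_of_real (1 + sqrt 2) - z))"

definition phi_S :: "complex \<Rightarrow> complex" where
  "phi_S z = 1 + sin z"

lemma phi_R_admissible: "phi_R holomorphic_on ball 0 1" "phi_R 0 = 1"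
proof -
  have "complex_of_real (1 + sqrt 2) - z \<noteq> 0" if "z \<in> ball 0 1" for z
  proof
    assume "complex_of_real (1 + sqrt 2) - z = 0"
    then have "norm z = 1 + sqrt 2"
      by (metis abs_of_nonneg add_nonneg_nonneg norm_of_real real_sqrt_ge_zero
            right_minus_eq zero_le_numeral zero_le_one)
    with that show False by simp
  qed
  moreover have "complex_of_real (1 + sqrt 2) \<noteq> 0"
    by (metis add_pos_pos less_irrefl of_real_eq_0_iff real_sqrt_gt_zero zero_less_numeral zero_less_one)
  ultimately show "phi_R holomorphic_on ball 0 1"
    unfolding phi_R_def by (intro holomorphic_intros) (simp only: mult_eq_0_iff, blast)
  show "phi_R 0 = 1"
    by (simp add: phi_R_def)
qed

lemma phi_S_admissible: "phi_S holomorphic_on ball 0 1" "phi_S 0 = 1"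
  unfolding phi_S_def by (intro holomorphic_intros) simp

end

theory Submission
  imports Defs
begin

text \<open>
  Put $k = 1 + \sqrt 2$; the claimed radius $\rho$ is the positive root of
  $\rho(k + \rho) = k(k - \rho)\sin 1$, that is, $\varphi_R(\rho) = 1 + \sin 1$.  Since the Taylor
  coefficients of $\varphi_R$ are nonnegative, $|\varphi_R - 1| < \sin 1$ on $|z| < \rho$, while
  the image of the unit disc under the sine contains the disc $|w| < \sin 1$; with Schwarz's lemma
  this gives the lower bound.  For the upper bound, $z e^{-z/k}(1 - z/k)^{-2}$ has quotient
  exactly $\varphi_R$, and for $r > \rho$ the point $z = \rho/r$ of the disc would require a
  point of the disc at which the sine equals $\sin 1$; there is none.
\<close>

section \<open>The sine on the unit disc\<close>

text \<open>Sine is concave on [0,1], so it lies above the chord from the origin to (1, sin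
  1).\<close>

lemma mult_sin_one_le_sin:
  fixes x :: real
  assumes "0 \<le> x" "x \<le> 1"
  shows "x * sin 1 \<le> sin x"
proof -
  have "convex_on {0..1} (\<lambda>t::real. - sin t)"
  proof (rule f''_ge0_imp_convex)
    fix t :: real assume t: "t \<in> {0..1}"
    show "((\<lambda>t. - sin t) has_real_derivative - cos t) (at t)"
      by (auto intro!: derivative_eq_intros)
    show "((\<lambda>t. - cos t) has_real_derivative sin t) (at t)"
      by (auto intro!: derivative_eq_intros)
    show "0 \<le> sin t"
      using t pi_gt3 by (intro sin_ge_zero) auto
  qed auto
  from convex_onD[OF this, of x 0 1] assms show ?thesis
    by simp
qed

text \<open>This form separates real and imaginary parts, so that each summand can be bounded on its
  own.\<close>

lemma norm_sin_squared_sinh: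
  fixes z :: complex
  shows "(norm (sin z))\<^sup>2 = (sin (Re z))\<^sup>2 + (sinh (Im z))\<^sup>2"
proof -
  have "4 * (norm (sin z))\<^sup>2 = (exp (Im z))\<^sup>2 + (exp (- Im z))\<^sup>2 - 2 * (1 - 2 * (sin (Re z))\<^sup>2)"
    by (simp add: norm_sin_squared cos_double_sin exp_double exp_minus power_inverse)
  moreover have "2 * sinh (Im z) = exp (Im z) - exp (- Im z)"
    by (simp add: sinh_def)
  moreover have "exp (Im z) * exp (- Im z) = 1"
    by (simp add: exp_minus)
  ultimately show ?thesis
    by algebra
qed

text \<open>Let x = |Re z| and y = Im z. If x is at least 1, monotonicity of sine on [0, pi/2]
  suffices. Otherwise sin^2 x >= x^2 sin^2 1 by concavity, while sinh^2 y >= y^2 >= 1 - x^2 >= (1 -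
  x^2) sin^2 1; the two bounds add up to sin^2 1.\<close>

lemma sin_one_le_norm_sin:
  fixes z :: complex
  assumes "1 \<le> norm z" "\<bar>Re z\<bar> \<le> pi / 2"
  shows "sin 1 \<le> norm (sin z)"
proof (rule power2_le_imp_le)
  define x where "x = \<bar>Re z\<bar>"
  have sin1: "0 \<le> sin (1::real)"
    using pi_gt3 by (intro sin_ge_zero) auto
  have sinx: "(sin (Re z))\<^sup>2 = (sin x)\<^sup>2"
    by (auto simp: x_def abs_if)
  show "(sin 1)\<^sup>2 \<le> (norm (sin z))\<^sup>2"
  proof (cases "1 \<le> x")
    case True
    have "sin 1 \<le> sin x"
      using True assms(2) pi_gt3 by (intro sin_monotone_2pi_le) (auto simp: x_def)
    then have "(sin 1)\<^sup>2 \<le> (sin x)\<^sup>2"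
      using sin1 by (rule power_mono)
    then show ?thesis
      unfolding norm_sin_squared_sinh sinx by (smt (verit) zero_le_power2)
  next
    case False
    have "1 \<le> x\<^sup>2 + (Im z)\<^sup>2"
      using assms(1) by (simp add: x_def cmod_def)
    have "(sin (1::real))\<^sup>2 \<le> 1"
      by (simp add: abs_square_le_1)
    moreover have "x\<^sup>2 \<le> 1"
      using False by (simp add: abs_square_le_1 x_def)
    ultimately have "(1 - x\<^sup>2) * (sin 1)\<^sup>2 \<le> 1 - x\<^sup>2"
      by (intro mult_left_le) auto
    with \<open>1 \<le> x\<^sup>2 + (Im z)\<^sup>2\<close> have "(sin 1)\<^sup>2 \<le> x\<^sup>2 * (sin 1)\<^sup>2 + (Im z)\<^sup>2"
      by (simp add: algebra_simps)
    moreover have "x\<^sup>2 * (sin 1)\<^sup>2 \<le> (sin x)\<^sup>2"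
      using power_mono[OF mult_sin_one_le_sin[of x], of 2] False sin1
      by (simp add: x_def power_mult_distrib)
    moreover have "(Im z)\<^sup>2 \<le> (sinh (Im z))\<^sup>2"
      using real_le_abs_sinh[of "Im z"] by (simp add: sinh_def exp_minus flip: abs_le_square_iff)
    ultimately show ?thesis
      unfolding norm_sin_squared_sinh sinx by linarith
  qed
qed simp

text \<open>\<open>Arcsin w\<close> lies in the strip |Re| < pi/2 and has sine \<open>w\<close>, so
  leaving the unit disc would contradict \<open>sin_one_le_norm_sin\<close>.\<close>

lemma norm_Arcsin_less_one:
  assumes "norm w < sin 1"
  shows "norm (Arcsin w) < 1"
proof (rule ccontr)
  assume "\<not> norm (Arcsin w) < 1"
  moreover have "\<bar>Re w\<bar> < 1"
    using assms abs_Re_le_cmod[of w] sin_le_one[of 1] by linarith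
  then have "\<bar>Re (Arcsin w)\<bar> < pi / 2"
    by (rule Arcsin_bounds)
  ultimately have "sin 1 \<le> norm (sin (Arcsin w))"
    by (intro sin_one_le_norm_sin) auto
  with assms show False
    by simp
qed

text \<open>Both \<open>w\<close> and 1 lie in the strip |Re| < pi/2, where \<open>Arcsin\<close>
  inverts the sine; equal sines would force \<open>w\<close> = 1.\<close>

lemma sin_neq_sin_one:
  fixes w :: complex
  assumes "norm w < 1"
  shows "sin w \<noteq> of_real (sin 1)"
proof
  assume "sin w = of_real (sin 1)"
  also have "\<dots> = sin 1"
    using sin_of_real[of 1, where ?'a = complex] by simp
  finally have "Arcsin (sin w) = Arcsin (sin 1)"
    by simp
  moreover have "Arcsin (sin w) = w"
    using assms abs_Re_le_cmod[of w] pi_gt3 by (intro Arcsin_sin) linarith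
  moreover have "Arcsin (sin 1) = (1 :: complex)"
    using pi_gt3 by (intro Arcsin_sin) simp
  ultimately show False
    using assms by simp
qed

section \<open>The radius \<open>rho\<close> and the size of \<open>phi_R\<close>\<close>

definition silver :: real where
  "silver = 1 + sqrt 2"

lemma silver_gt_two: "2 < silver"
  by (simp add: silver_def)

lemma silver_squared: "silver\<^sup>2 = 2 * silver + 1"
  by (simp add: silver_def power2_eq_square algebra_simps)

lemma phi_R_altdef:
  "phi_R z = 1 + z * (of_real silver + z) / (of_real silver * (of_real silver - z))"
  by (simp add: phi_R_def silver_def)

definition rho :: real where
  "rho = silver * (sqrt (1 + 6 * sin 1 + (sin 1)\<^sup>2) - 1 - sin 1) / 2"

lemma sin_one_pos: "0 < sin (1::real)"
  using pi_gt3 by (intro sin_gt_zero) auto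

text \<open>As a quadratic in \<open>rho\<close>, this has discriminant silver^2 ((1 + sin 1)^2 + 4
  sin 1), which is the radicand of \<open>rho_def\<close> times silver^2.\<close>

lemma rho_equation: "rho * (silver + rho) = sin 1 * (silver * (silver - rho))"
proof -
  define q where "q = sqrt (1 + 6 * sin 1 + (sin (1::real))\<^sup>2)"
  have "q\<^sup>2 = 1 + 6 * sin 1 + (sin 1)\<^sup>2"
    using sin_one_pos by (simp add: q_def)
  moreover have "rho = silver * (q - 1 - sin 1) / 2"
    by (simp add: rho_def q_def)
  ultimately show ?thesis
    by algebra
qed

lemma rho_pos: "0 < rho"
proof -
  have "1 + sin 1 < sqrt (1 + 6 * sin 1 + (sin (1::real))\<^sup>2)"
    using sin_one_pos by (intro real_less_rsqrt) (simp add: power2_eq_square algebra_simps)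
  then show ?thesis
    using silver_gt_two by (simp add: rho_def)
qed

text \<open>By \<open>silver_squared\<close>, \<open>silver * (silver - 1) = silver + 1\<close>, so
  \<open>phi_R\<close> takes the value 2 >= 1 + sin 1 at 1. Past 1 the left side of
  \<open>rho_equation\<close> would exceed \<open>silver + 1\<close> and the right side would
  not.\<close>

lemma rho_le_one: "rho \<le> 1"
proof (rule ccontr)
  assume "\<not> rho \<le> 1"
  then have "1 * (silver + 1) < rho * (silver + rho)"
    using silver_gt_two by (intro mult_strict_mono) auto
  also have "\<dots> \<le> 1 * (silver * (silver - 1))"
  proof -
    have "sin 1 * (silver * (silver - rho)) \<le> sin 1 * (silver * (silver - 1))"
      using \<open>\<not> rho \<le> 1\<close> silver_gt_two sin_one_pos by (intro mult_left_mono) auto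
    also have "\<dots> \<le> 1 * (silver * (silver - 1))"
      using silver_gt_two by (intro mult_right_mono) auto
    finally show ?thesis
      by (simp add: rho_equation)
  qed
  also have "\<dots> = silver + 1"
    using silver_squared by (simp add: algebra_simps power2_eq_square)
  finally show False
    by simp
qed

lemma silver_minus_neq_zero:
  fixes z :: complex
  assumes "norm z \<le> 1"
  shows "of_real silver - z \<noteq> 0"
proof
  assume "of_real silver - z = 0"
  then have "norm z = \<bar>silver\<bar>"
    by (metis norm_of_real right_minus_eq)
  with assms silver_gt_two show False
    by simp
qed

text \<open>The triangle inequality, applied to numerator and denominator separately, bounds the
  norm by the value of \<open>phi_R - 1\<close> at |z|, which is less than its value sin 1 at
  \<open>rho\<close>.\<close>

lemma norm_phi_R_minus_one_less:
  assumes "norm z < rho"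
  shows "norm (phi_R z - 1) < sin 1"
proof -
  let ?k = "of_real silver :: complex"
  have z1: "norm z \<le> 1"
    using assms rho_le_one by simp
  have "norm (?k + z) \<le> silver + norm z"
    using norm_triangle_ineq[of ?k z] silver_gt_two by simp
  moreover have denom: "silver - norm z \<le> norm (?k - z)"
    using norm_triangle_ineq2[of ?k z] silver_gt_two by simp
  ultimately have "norm (z * (?k + z)) \<le> norm z * (silver + norm z)"
    by (simp add: norm_mult mult_left_mono)
  also have "\<dots> \<le> rho * (silver + rho)"
    using assms silver_gt_two rho_pos by (intro mult_mono) auto
  \<comment> \<open>Strictness enters here, through
    \<open>silver - rho < silver - norm z\<close>.\<close>
  also have "\<dots> < sin 1 * (silver * (silver - norm z))"
    unfolding rho_equation using assms sin_one_pos silver_gt_two by simp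
  also have "\<dots> \<le> sin 1 * norm (?k * (?k - z))"
    using denom sin_one_pos silver_gt_two by (simp add: norm_mult)
  finally show ?thesis
    using silver_minus_neq_zero[OF z1] silver_gt_two
    by (simp add: phi_R_altdef norm_divide divide_less_eq)
qed

lemma phi_R_rho: "phi_R (of_real rho) = 1 + of_real (sin 1)"
proof -
  have "rho * (silver + rho) / (silver * (silver - rho)) = sin 1"
    using rho_le_one silver_gt_two by (simp add: rho_equation)
  then show ?thesis
    unfolding phi_R_altdef by (simp flip: of_real_add of_real_diff of_real_mult of_real_divide)
qed

section \<open>Dilations\<close>

lemma scale_mem_unit_ball:
  fixes z :: complex
  assumes "0 < r" "r \<le> 1" "z \<in> ball 0 1"
  shows "of_real r * z \<in> ball 0 1"
  using assms mult_le_one[of r "norm z"] mult_left_le_one_le[of "norm z" r]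
  by (auto simp: norm_mult)

lemma deriv_dilation:
  fixes f :: "complex \<Rightarrow> complex"
  assumes "f holomorphic_on ball 0 1" "0 < r" "r \<le> 1" "z \<in> ball 0 1"
  shows "((\<lambda>z. f (of_real r * z) / of_real r) has_field_derivative deriv f (of_real r * z)) (at z)"
proof -
  have "(f has_field_derivative deriv f (of_real r * z)) (at (of_real r * z))"
    using assms scale_mem_unit_ball by (intro holomorphic_derivI[of f "ball 0 1"]) auto
  then have "((\<lambda>z. f (of_real r * z)) has_field_derivative deriv f (of_real r * z) * of_real r) (at z)"
    by (rule DERIV_chain2) (auto intro!: derivative_eq_intros)
  from DERIV_cdivide[OF this, of "of_real r"] show ?thesis
    using assms by simp
qed

text \<open>The divisor \<open>r\<close> of the dilated function supplies the factor that turns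
  \<open>z\<close> into \<open>r * z\<close> in the numerator; at 0 both sides are 1 by
  convention.\<close>

lemma starlike_quotient_dilation:
  assumes "f holomorphic_on ball 0 1" "0 < r" "r \<le> 1" "z \<in> ball 0 1"
  shows "starlike_quotient (\<lambda>z. f (of_real r * z) / of_real r) z = starlike_quotient f (of_real r * z)"
  using DERIV_imp_deriv[OF deriv_dilation[OF assms]] assms
  by (simp add: starlike_quotient_def mult_ac)

lemma dilation_in_class_A:
  assumes "f \<in> class_A" "0 < r" "r \<le> 1"
  shows "(\<lambda>z. f (of_real r * z) / of_real r) \<in> class_A"
proof -
  have f: "f holomorphic_on ball 0 1" "f 0 = 0" "deriv f 0 = 1"
    using assms by (auto simp: class_A_def)
  note der = deriv_dilation[OF f(1) assms(2,3)]
  have "(\<lambda>z. f (of_real r * z) / of_real r) holomorphic_on ball 0 1"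
    using der unfolding holomorphic_on_open[OF open_ball] by blast
  moreover have "deriv (\<lambda>z. f (of_real r * z) / of_real r) 0 = 1"
    using DERIV_imp_deriv[OF der[of 0]] f by simp
  ultimately show ?thesis
    using f by (simp add: class_A_def)
qed

section \<open>The lower bound\<close>

lemma dilation_rho_in_S_star:
  assumes "f \<in> S_star phi_R"
  shows "(\<lambda>z. f (of_real rho * z) / of_real rho) \<in> S_star phi_S"
proof -
  let ?h = "\<lambda>z. f (of_real rho * z) / of_real rho"
  have fA: "f \<in> class_A" and nz: "\<And>z. z \<in> ball 0 1 - {0} \<Longrightarrow> f z \<noteq> 0"
    using assms by (auto simp: S_star_def)
  have fhol: "f holomorphic_on ball 0 1"
    using fA by (simp add: class_A_def)
  from assms obtain \<omega> where \<omega>: "\<omega> holomorphic_on ball 0 1" "\<omega> ` ball 0 1 \<subseteq> ball 0 1" "\<omega> 0 = 0"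
    "\<And>z. z \<in> ball 0 1 \<Longrightarrow> starlike_quotient f z = phi_R (\<omega> z)"
    by (auto simp: S_star_def subordinate_def)
  note scale = scale_mem_unit_ball[OF rho_pos rho_le_one]
  have bound: "norm (\<omega> (of_real rho * z)) < rho" if "z \<in> ball 0 1" for z
  proof -
    \<comment> \<open>Schwarz's lemma for \<open>\<omega>\<close>.\<close>
    have "norm (\<omega> (of_real rho * z)) \<le> norm (of_real rho * z)"
      using scale[OF that] \<omega> by (intro Schwarz_Lemma(1)) (auto simp: image_subset_iff)
    also have "\<dots> < rho"
      using that rho_pos by (simp add: norm_mult)
    finally show ?thesis .
  qed
  \<comment> \<open>Since \<open>phi_S\<close> is 1 plus sine, \<open>Arcsin (p z)\<close> solves
    the subordination equation and will serve as the new Schwarz function.\<close>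
  define p where "p z = phi_R (\<omega> (of_real rho * z)) - 1" for z
  have p_bound: "norm (p z) < sin 1" if "z \<in> ball 0 1" for z
    unfolding p_def using bound[OF that] by (rule norm_phi_R_minus_one_less)
  have "(\<lambda>z. \<omega> (of_real rho * z)) holomorphic_on ball 0 1"
    using scale by (intro holomorphic_on_compose_gen[OF _ \<omega>(1), unfolded o_def] holomorphic_intros) auto
  then have "p holomorphic_on ball 0 1"
    unfolding p_def using scale \<omega>(2)
    by (intro holomorphic_intros holomorphic_on_compose_gen[OF _ phi_R_admissible(1), unfolded o_def]) auto
  \<comment> \<open>As sin 1 is at most 1, this disc avoids the branch cuts of \<open>Arcsin\<close>
    on the real axis.\<close>
  moreover have "Arcsin holomorphic_on ball 0 (sin 1)"
  proof (rule holomorphic_on_Arcsin)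
    fix w :: complex assume "w \<in> ball 0 (sin 1)"
    then show "\<bar>Re w\<bar> < 1"
      using abs_Re_le_cmod[of w] sin_le_one[of "1::real"] by (simp del: sin_le_one)
  qed
  ultimately have "(\<lambda>z. Arcsin (p z)) holomorphic_on ball 0 1"
    using p_bound by (intro holomorphic_on_compose_gen[of p _ Arcsin, unfolded o_def]) auto
  moreover have "(\<lambda>z. Arcsin (p z)) ` ball 0 1 \<subseteq> ball 0 1"
    using p_bound norm_Arcsin_less_one by auto
  moreover have "Arcsin (p 0) = 0"
    by (simp add: p_def \<omega> phi_R_admissible)
  moreover have "starlike_quotient ?h z = phi_S (Arcsin (p z))" if "z \<in> ball 0 1" for z
    using starlike_quotient_dilation[OF fhol rho_pos rho_le_one that] scale[OF that] \<omega>(4)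
    by (simp add: phi_S_def p_def)
  ultimately have "subordinate (starlike_quotient ?h) phi_S"
    unfolding subordinate_def by blast
  moreover have "?h z \<noteq> 0" if "z \<in> ball 0 1 - {0}" for z
    using nz[of "of_real rho * z"] scale[of z] that rho_pos by simp
  ultimately show ?thesis
    using dilation_in_class_A[OF fA rho_pos rho_le_one] by (simp add: S_star_def)
qed

section \<open>The extremal function\<close>

text \<open>This is $z\exp\int_0^z (\varphi_R(t) - 1)/t\,dt$, the solution of $zf'/f = \varphi_R$.\<close>

definition extremal :: "complex \<Rightarrow> complex" where
  "extremal z = z * exp (- z / of_real silver) * (of_real silver)\<^sup>2 / (of_real silver - z)\<^sup>2"

lemma extremal_eq_0_iff: "z \<in> ball 0 1 \<Longrightarrow> extremal z = 0 \<longleftrightarrow> z = 0"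
  using silver_gt_two silver_minus_neq_zero[of z] by (auto simp: extremal_def)

text \<open>The factor after \<open>phi_R z\<close> is \<open>extremal z / z\<close> with
  \<open>z\<close> cancelled, which keeps the formula valid at 0.\<close>

lemma extremal_has_field_derivative:
  assumes "z \<in> ball 0 1"
  shows "(extremal has_field_derivative
    phi_R z * (exp (- z / of_real silver) * (of_real silver)\<^sup>2 / (of_real silver - z)\<^sup>2)) (at z)"
proof -
  define k where "k = (of_real silver :: complex)"
  have nz: "k - z \<noteq> 0" "k \<noteq> 0"
    using assms silver_gt_two silver_minus_neq_zero[of z] by (auto simp: k_def)
  have "(extremal has_field_derivative
      ((1 - z / k) * exp (- z / k) * k\<^sup>2 * (k - z)\<^sup>2 + z * exp (- z / k) * k\<^sup>2 * (2 * (k - z))) /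
      ((k - z)\<^sup>2)\<^sup>2) (at z)"
    unfolding extremal_def[abs_def] k_def[symmetric] using nz
    by (auto intro!: derivative_eq_intros) (simp add: algebra_simps power2_eq_square)
  also have "((1 - z / k) * exp (- z / k) * k\<^sup>2 * (k - z)\<^sup>2 + z * exp (- z / k) * k\<^sup>2 * (2 * (k - z))) /
      ((k - z)\<^sup>2)\<^sup>2 = ((1 - z / k) + 2 * z / (k - z)) * (exp (- z / k) * k\<^sup>2 / (k - z)\<^sup>2)"
  proof -
    \<comment> \<open>Abstracting the exponential and the other factors leaves a purely rational
      identity.\<close>
    have "(a * e * c * d\<^sup>2 + z * e * c * (2 * d)) / (d\<^sup>2)\<^sup>2 = (a + 2 * z / d) * (e * c / d\<^sup>2)"
      if "d \<noteq> 0" for a c d e :: complex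
      using that by (simp add: field_simps power2_eq_square)
    then show ?thesis
      using nz(1) .
  qed
  \<comment> \<open>The left side is the logarithmic derivative of \<open>extremal\<close> times
    \<open>z\<close>.\<close>
  also have "(1 - z / k) + 2 * z / (k - z) = phi_R z"
    unfolding phi_R_altdef k_def[symmetric] using nz by (simp add: field_simps)
  finally show ?thesis
    by (simp add: k_def)
qed

lemma starlike_quotient_extremal:
  assumes "z \<in> ball 0 1"
  shows "starlike_quotient extremal z = phi_R z"
  using DERIV_imp_deriv[OF extremal_has_field_derivative[OF assms]] assms
    silver_gt_two silver_minus_neq_zero[of z]
  by (auto simp: starlike_quotient_def phi_R_admissible extremal_def)

lemma extremal_in_S_star: "extremal \<in> S_star phi_R"
proof -
  have "extremal holomorphic_on ball 0 1"
    using extremal_has_field_derivative unfolding holomorphic_on_open[OF open_ball] by blast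
  moreover have "deriv extremal 0 = 1"
    using DERIV_imp_deriv[OF extremal_has_field_derivative[of 0]] silver_gt_two
    by (simp add: phi_R_admissible)
  ultimately have "extremal \<in> class_A"
    by (simp add: class_A_def extremal_def)
  moreover have "subordinate (starlike_quotient extremal) phi_R"
    unfolding subordinate_def using starlike_quotient_extremal by (intro exI[of _ "\<lambda>z. z"]) auto
  ultimately show ?thesis
    using extremal_eq_0_iff by (auto simp: S_star_def)
qed

section \<open>The upper bound\<close>

lemma dilation_extremal_not_in_S_star:
  assumes "rho < r" "r \<le> 1"
  shows "(\<lambda>z. extremal (of_real r * z) / of_real r) \<notin> S_star phi_S"
proof
  have r: "0 < r"
    using assms rho_pos by simp
  \<comment> \<open>Dilation by \<open>r\<close> carries this point to \<open>rho\<close>, where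
    \<open>phi_R\<close> equals 1 + sin 1; it lies in the disc because
    \<open>rho < r\<close>.\<close>
  define z where "z = (of_real (rho / r) :: complex)"
  have z: "z \<in> ball 0 1"
    using assms r rho_pos by (simp add: z_def norm_divide)
  have rz: "of_real r * z = of_real rho"
    using r by (simp add: z_def)
  have hol: "extremal holomorphic_on ball 0 1"
    using extremal_in_S_star by (simp add: S_star_def class_A_def)
  assume "(\<lambda>z. extremal (of_real r * z) / of_real r) \<in> S_star phi_S"
  then obtain \<omega> where \<omega>: "\<omega> ` ball 0 1 \<subseteq> ball 0 1"
    "starlike_quotient (\<lambda>z. extremal (of_real r * z) / of_real r) z = phi_S (\<omega> z)"
    using z by (auto simp: S_star_def subordinate_def)
  have "of_real rho \<in> ball (0::complex) 1"
    using scale_mem_unit_ball[OF r assms(2) z] rz by simp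
  then have "phi_S (\<omega> z) = 1 + of_real (sin 1)"
    using starlike_quotient_dilation[OF hol r assms(2) z] \<omega>(2)
    by (simp add: rz starlike_quotient_extremal phi_R_rho)
  then have "sin (\<omega> z) = of_real (sin 1)"
    by (simp add: phi_S_def)
  moreover have "norm (\<omega> z) < 1"
    using \<omega>(1) z by (auto simp: image_subset_iff)
  ultimately show False
    using sin_neq_sin_one by blast
qed

theorem theorem7p4:
  shows "S_star_radius phi_S phi_R =
         (1 + sqrt 2) * (sqrt (1 + 6 * sin 1 + (sin 1)\<^sup>2) - 1 - sin 1) / 2"
proof -
  have "S_star_radius phi_S phi_R = rho"
    unfolding S_star_radius_def
  \<comment> \<open>The supremum is attained at \<open>rho\<close>; \<open>extremal\<close> excludes
    every larger \<open>r\<close>.\<close>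
  proof (rule cSup_eq_maximum)
    show "rho \<in> {r \<in> {0<..1}. \<forall>f\<in>S_star phi_R.
            (\<lambda>z. f (complex_of_real r * z) / complex_of_real r) \<in> S_star phi_S}"
      using rho_pos rho_le_one dilation_rho_in_S_star by simp
  next
    fix r assume "r \<in> {r \<in> {0<..1}. \<forall>f\<in>S_star phi_R.
            (\<lambda>z. f (complex_of_real r * z) / complex_of_real r) \<in> S_star phi_S}"
    then show "r \<le> rho"
      using dilation_extremal_not_in_S_star extremal_in_S_star
      by (auto simp flip: not_less)
  qed
  then show ?thesis
    by (simp add: rho_def silver_def)
qed

end
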